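(* Let $\delta>1$ be an integer. For every finite connected simple $\delta$-regular (undirected) graph $H$ with $n$ vertices, diameter $k$, and average distance $\overline{k}$, there is a $(1,\delta-1,k+1)$-mixed graph $G$, with undirected degree $1$, directed degree $\delta-1$, order $\delta n$, diameter $k+1$, and average distance smaller than $\overline{k}+1$.
   Context: A mixed graph may contain (undirected) edges as well as directed edges (arcs); there are no loops or parallel edges/arcs, and a digon (a pair of opposite arcs) is always considered as an edge. An $(r,z,k)$-mixed graph is a mixed graph in which every vertex has undirected degree $r$ (is incident to exactly $r$ edges) and directed degree $z$ (has exactly $z$ outgoing and $z$ incoming arcs), and whose diameter is $k$. Walks may traverse edges in both directions and arcs only in their direction; $\mathrm{dist}(u,v)$ is the length of a shortest walk from $u$ to $v$, and the diameter is the maximum of $\mathrm{dist}(u,v)$ over all ordered pairs of vertices. The average distance of a graph or mixed graph with vertex set $V$, $|V|=n$, is $\overline{k}=\frac{1}{n^2}\sum_{u,v\in V}\mathrm{dist}(u,v)$, the sum being over all ordered pairs $(u,v)$, including $u=v$. *)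

theory Defs
  imports "Graph_Theory.Graph_Theory"
begin

text \<open>
  Finite simple undirected graphs are the symmetric digraphs \<open>pair_graph\<close> of
  \<open>Graph_Theory\<close>: the edge \<open>uv\<close> is the pair of arcs \<open>(u, v)\<close>, \<open>(v, u)\<close>, so the degree
  of a vertex is its out-degree. Distances of undirected and of mixed graphs
  are both taken in the digraph of permitted steps; \<open>wf_digraph.\<mu>\<close> with unit costs is the least
  length of a walk, and it is \<open>\<infinity>\<close> if there is none.
\<close>

definition dist_on :: "('a, 'b) pre_digraph \<Rightarrow> 'a \<Rightarrow> 'a \<Rightarrow> ereal" where
  "dist_on D u v = wf_digraph.\<mu> D (\<lambda>_. 1) u v"

definition diameter_on :: "('a, 'b) pre_digraph \<Rightarrow> ereal" where
  "diameter_on D = (SUP (u, v) \<in> verts D \<times> verts D. dist_on D u v)"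

text \<open>
  \<open>real_of_ereal \<infinity> = 0\<close>, so the following is the average distance only for finite diameter.
\<close>

definition average_distance :: "('a, 'b) pre_digraph \<Rightarrow> real" where
  "average_distance D =
     (\<Sum>(u, v) \<in> verts D \<times> verts D. real_of_ereal (dist_on D u v)) / (real (card (verts D)))\<^sup>2"

record 'a mixed_graph =
  mverts :: "'a set"
  medges :: "'a set set"
  marcs :: "('a \<times> 'a) set"

locale mixed_graph =
  fixes M :: "'a mixed_graph"
  assumes finite_mverts: "finite (mverts M)"
    and medges_in_mverts: "e \<in> medges M \<Longrightarrow> e \<subseteq> mverts M"
    and card_medge: "e \<in> medges M \<Longrightarrow> card e = 2"
    and marcs_in_mverts: "(u, v) \<in> marcs M \<Longrightarrow> u \<in> mverts M \<and> v \<in> mverts M"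
    and no_loop: "(u, v) \<in> marcs M \<Longrightarrow> u \<noteq> v"
    and no_digon: "(u, v) \<in> marcs M \<Longrightarrow> (v, u) \<notin> marcs M"
    and no_edge_parallel_to_arc: "(u, v) \<in> marcs M \<Longrightarrow> {u, v} \<notin> medges M"

definition step_digraph :: "'a mixed_graph \<Rightarrow> 'a pair_pre_digraph" where
  "step_digraph M =
     \<lparr> pverts = mverts M, parcs = marcs M \<union> {(u, v). {u, v} \<in> medges M} \<rparr>"

definition undirected_degree :: "'a mixed_graph \<Rightarrow> 'a \<Rightarrow> nat" where
  "undirected_degree M v = card {e \<in> medges M. v \<in> e}"

definition arc_out_degree :: "'a mixed_graph \<Rightarrow> 'a \<Rightarrow> nat" where
  "arc_out_degree M v = card {a \<in> marcs M. fst a = v}"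

definition arc_in_degree :: "'a mixed_graph \<Rightarrow> 'a \<Rightarrow> nat" where
  "arc_in_degree M v = card {a \<in> marcs M. snd a = v}"

locale rzk_mixed_graph = mixed_graph M
  for r z k :: nat and M :: "'a mixed_graph" +
  assumes undirected_degree: "v \<in> mverts M \<Longrightarrow> undirected_degree M v = r"
    and arc_out_degree: "v \<in> mverts M \<Longrightarrow> arc_out_degree M v = z"
    and arc_in_degree: "v \<in> mverts M \<Longrightarrow> arc_in_degree M v = z"
    and diameter: "diameter_on (with_proj (step_digraph M)) = ereal (real k)"

text \<open>
  In particular \<open>wf_digraph\<close> holds, which \<open>wf_digraph.\<mu>\<close> presupposes.
\<close>

lemma (in mixed_graph) pair_digraph_step_digraph: "pair_digraph (step_digraph M)"
proof -
  have edge: "u \<in> mverts M \<and> v \<in> mverts M \<and> u \<noteq> v" if "{u, v} \<in> medges M" for u v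
    using medges_in_mverts[OF that] card_medge[OF that] by auto
  have fin: "finite (parcs (step_digraph M))"
    by (rule finite_subset[of _ "mverts M \<times> mverts M"])
      (use edge marcs_in_mverts finite_mverts in \<open>auto simp: step_digraph_def\<close>)
  show ?thesis
    by unfold_locales
      (use edge marcs_in_mverts no_loop finite_mverts fin in \<open>auto simp: step_digraph_def\<close>)
qed

end

theory Submission
  imports Defs
begin

text \<open>
  \<open>G\<close> is the line digraph of \<open>H\<close>: its vertices are the arcs of \<open>H\<close>, and \<open>uv\<close> precedes \<open>vw\<close>. The only
  digons join an arc \<open>uv\<close> to its reverse \<open>vu\<close>, which gives undirected degree \<open>1\<close>. A walk of length
  \<open>m + 1\<close> from \<open>uv\<close> to \<open>xy\<close> in \<open>G\<close> is a walk of length \<open>m\<close> from \<open>v\<close> to \<open>x\<close> in \<open>H\<close>, so distinct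
  vertices satisfy \<open>dist(uv, xy) = dist(v, x) + 1\<close>. Since each vertex of \<open>H\<close> is the head and the
  tail of equally many arcs, averaging the right-hand side over all pairs gives \<open>kbar + 1\<close>; the
  inequality is strict because the diagonal pairs have distance \<open>0\<close>.
\<close>

section \<open>Distances\<close>

text \<open>Relational powers replace walks, so that distances in two digraphs can be compared by
  induction on an exponent. \<open>u \<in> verts G\<close> matters for \<open>n = 0\<close>: an
  empty walk needs a vertex, \<open>Id\<close> does not.\<close>

lemma (in wf_digraph) awalk_length_iff_relpow:
  assumes "u \<in> verts G"
  shows "(\<exists>p. awalk u p v \<and> length p = n) \<longleftrightarrow> (u, v) \<in> arcs_ends G ^^ n"
  using assms
proof (induction n arbitrary: u)
  case 0
  then show ?case by (auto simp: awalk_Nil_iff)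
next
  case (Suc n)
  have "(\<exists>p. awalk u p v \<and> length p = Suc n) \<longleftrightarrow> (\<exists>e p. awalk u (e # p) v \<and> length p = n)"
    by (metis Suc_length_conv)
  also have "\<dots> \<longleftrightarrow>
      (\<exists>e \<in> arcs G. tail G e = u \<and> (\<exists>p. awalk (head G e) p v \<and> length p = n))"
    by (auto simp: awalk_Cons_iff)
  also have "\<dots> \<longleftrightarrow> (\<exists>e \<in> arcs G. tail G e = u \<and> (head G e, v) \<in> arcs_ends G ^^ n)"
    by (intro bex_cong conj_cong refl Suc.IH) (rule head_in_verts)
  \<comment> \<open>\<open>relpow\<close> splits off the last step, a walk its first arc;
    \<open>relpow_commute\<close> reconciles them.\<close>
  also have "\<dots> \<longleftrightarrow> (u, v) \<in> arcs_ends G ^^ Suc n"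
    by (simp only: relpow.simps(2) relpow_commute[symmetric] arcs_ends_conv) auto
  finally show ?case .
qed

text \<open>Unreachable pairs are covered: the infimum over the empty set is \<infinity>.\<close>

lemma (in wf_digraph) dist_on_eq_INF_relpow:
  assumes "u \<in> verts G"
  shows "dist_on G u v = (INF n \<in> {n. (u, v) \<in> arcs_ends G ^^ n}. ereal (real n))"
proof -
  have "awalk_cost (\<lambda>_. 1) p = real (length p)" for p
    by (induction p) auto
  then have "dist_on G u v = Inf ((\<lambda>n. ereal (real n)) ` length ` {p. awalk u p v})"
    by (simp add: dist_on_def \<mu>_def image_image)
  also have "length ` {p. awalk u p v} = {n. \<exists>p. awalk u p v \<and> length p = n}"
    by auto
  also have "\<dots> = {n. (u, v) \<in> arcs_ends G ^^ n}"
    by (simp only: awalk_length_iff_relpow[OF assms])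
  finally show ?thesis .
qed

lemma (in wf_digraph) dist_on_nonneg: "0 \<le> dist_on G u v"
  unfolding dist_on_def \<mu>_def by (rule INF_greatest) (simp add: pos_cost_pos_awalk_cost)

lemma (in wf_digraph) dist_on_refl: "u \<in> verts G \<Longrightarrow> dist_on G u u = 0"
  by (rule antisym[OF _ dist_on_nonneg]) (auto simp: dist_on_eq_INF_relpow intro!: INF_lower2[of 0])

lemma dist_on_le_diameter_on:
  "u \<in> verts D \<Longrightarrow> v \<in> verts D \<Longrightarrow> dist_on D u v \<le> diameter_on D"
  unfolding diameter_on_def by (rule SUP_upper2[of "(u, v)"]) auto

text \<open>Over finitely many pairs the supremum is a maximum; the extremal pair serves to bound
  another diameter from below.\<close>

lemma diameter_on_attained:
  assumes "finite (verts D)" "verts D \<noteq> {}"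
  obtains u v where "u \<in> verts D" "v \<in> verts D" "dist_on D u v = diameter_on D"
proof -
  let ?S = "(\<lambda>(u, v). dist_on D u v) ` (verts D \<times> verts D)"
  have "diameter_on D = Max ?S"
    unfolding diameter_on_def using assms by (intro Max_Sup[symmetric]) auto
  moreover have "Max ?S \<in> ?S"
    using assms by (intro Max_in) auto
  ultimately show ?thesis using that by auto
qed

section \<open>The line digraph as a mixed graph\<close>

text \<open>The condition \<open>w \<noteq> u\<close> keeps the digons between \<open>(u, v)\<close>
  and \<open>(v, u)\<close> out of \<open>marcs\<close>; they appear as edges instead.\<close>

definition line_mixed_graph :: "'a pair_pre_digraph \<Rightarrow> ('a \<times> 'a) mixed_graph" where
  "line_mixed_graph H =
     \<lparr> mverts = parcs H,
       medges = {{(u, v), (v, u)} | u v. (u, v) \<in> parcs H},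
       marcs = {((u, v), (v, w)) | u v w. (u, v) \<in> parcs H \<and> (v, w) \<in> parcs H \<and> w \<noteq> u} \<rparr>"

lemma mverts_line_mixed_graph [simp]: "mverts (line_mixed_graph H) = parcs H"
  by (simp add: line_mixed_graph_def)

context pair_graph
begin

lemma parcs_sym: "(u, v) \<in> parcs G \<Longrightarrow> (v, u) \<in> parcs G"
  using arcs_ends_symmetric[OF sym_arcs] by simp

lemma parcs_irrefl: "(u, u) \<notin> parcs G"
  using pair_no_loops by fastforce

lemma doubleton_in_medges_line:
  "{a, b} \<in> medges (line_mixed_graph G) \<longleftrightarrow>
     a \<in> parcs G \<and> b \<in> parcs G \<and> snd a = fst b \<and> fst a = snd b"
  (is "?L \<longleftrightarrow> ?R")
proof
  assume ?L
  then obtain u v where "{a, b} = {(u, v), (v, u)}" "(u, v) \<in> parcs G"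
    by (auto simp: line_mixed_graph_def)
  with parcs_sym[OF this(2)] show ?R
    by (auto simp: doubleton_eq_iff)
next
  assume ?R
  then show ?L
    by (cases a; cases b) (auto simp: line_mixed_graph_def)
qed

lemma medge_line_cases:
  assumes "e \<in> medges (line_mixed_graph G)"
  obtains a where "a \<in> parcs G" "e = {a, prod.swap a}"
  using assms by (force simp: line_mixed_graph_def)

lemma in_marcs_line:
  "(a, b) \<in> marcs (line_mixed_graph G) \<longleftrightarrow>
     a \<in> parcs G \<and> b \<in> parcs G \<and> snd a = fst b \<and> fst a \<noteq> snd b"
  by (cases a; cases b) (auto simp: line_mixed_graph_def)

lemma swap_in_parcs: "a \<in> parcs G \<Longrightarrow> prod.swap a \<in> parcs G"
  by (cases a) (simp add: parcs_sym)

lemma mixed_graph_line: "mixed_graph (line_mixed_graph G)"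
proof
  show "finite (mverts (line_mixed_graph G))"
    by (simp add: pair_finite_arcs)
next
  fix e assume "e \<in> medges (line_mixed_graph G)"
  then obtain a where a: "a \<in> parcs G" "e = {a, prod.swap a}"
    by (rule medge_line_cases)
  then show "e \<subseteq> mverts (line_mixed_graph G)"
    by (simp add: swap_in_parcs)
  have "a \<noteq> prod.swap a"
    using a(1) parcs_irrefl by (cases a) auto
  then show "card e = 2"
    using a(2) by simp
next
  fix a b assume "(a, b) \<in> marcs (line_mixed_graph G)"
  then have ab: "a \<in> parcs G" "b \<in> parcs G" "snd a = fst b" "fst a \<noteq> snd b"
    by (simp_all add: in_marcs_line)
  then show "a \<in> mverts (line_mixed_graph G) \<and> b \<in> mverts (line_mixed_graph G)"
    by simp
  show "a \<noteq> b"
    using ab by auto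
  \<comment> \<open>The opposite arc would need \<open>snd b = fst a\<close>, the case reserved for
    edges.\<close>
  show "(b, a) \<notin> marcs (line_mixed_graph G)"
    using ab by (simp add: in_marcs_line)
  show "{a, b} \<notin> medges (line_mixed_graph G)"
    using ab by (auto simp: doubleton_in_medges_line)
qed

section \<open>Walks and distances in the line digraph\<close>

sublocale line: pair_digraph "step_digraph (line_mixed_graph G)"
  by (rule mixed_graph.pair_digraph_step_digraph[OF mixed_graph_line])

lemma pverts_step_line [simp]: "pverts (step_digraph (line_mixed_graph G)) = parcs G"
  by (simp add: step_digraph_def)

text \<open>Edges contribute the successors with \<open>fst a = snd b\<close>, arcs all others, so
  the case distinction disappears from the permitted steps.\<close>

lemma parcs_step_line:
  "parcs (step_digraph (line_mixed_graph G)) = {(a, b). a \<in> parcs G \<and> b \<in> parcs G \<and> snd a = fst b}"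
  by (auto simp: step_digraph_def doubleton_in_medges_line in_marcs_line)

text \<open>Such a walk visits \<open>n + 2\<close> arcs of \<open>G\<close>; the \<open>n\<close>
  arcs strictly between \<open>a\<close> and \<open>b\<close> form a walk from the head of
  \<open>a\<close> to the tail of \<open>b\<close>.\<close>

lemma relpow_Suc_step_line:
  "(a, b) \<in> parcs (step_digraph (line_mixed_graph G)) ^^ Suc n \<longleftrightarrow>
     a \<in> parcs G \<and> b \<in> parcs G \<and> (snd a, fst b) \<in> parcs G ^^ n"
proof (induction n arbitrary: b)
  case 0
  show ?case by (auto simp: parcs_step_line)
next
  case (Suc n)
  let ?R = "parcs (step_digraph (line_mixed_graph G))"
  have "(a, b) \<in> ?R ^^ Suc (Suc n) \<longleftrightarrow> (\<exists>c. (a, c) \<in> ?R ^^ Suc n \<and> (c, b) \<in> ?R)"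
    by (simp only: relpow.simps(2)[of "Suc n"] relcomp_unfold mem_Collect_eq prod.case)
  also have "\<dots> \<longleftrightarrow> (\<exists>c. a \<in> parcs G \<and> b \<in> parcs G \<and> c \<in> parcs G \<and> snd c = fst b \<and>
      (snd a, fst c) \<in> parcs G ^^ n)"
    by (simp only: Suc.IH, simp only: parcs_step_line mem_Collect_eq prod.case) metis
  \<comment> \<open>The head of \<open>c\<close> is fixed as \<open>fst b\<close>, so
    \<open>c\<close> is determined by its tail \<open>x\<close>.\<close>
  also have "\<dots> \<longleftrightarrow> a \<in> parcs G \<and> b \<in> parcs G \<and>
      (\<exists>x. (snd a, x) \<in> parcs G ^^ n \<and> (x, fst b) \<in> parcs G)"
    by (simp only: split_paired_Ex fst_conv snd_conv) metis
  also have "\<dots> \<longleftrightarrow> a \<in> parcs G \<and> b \<in> parcs G \<and> (snd a, fst b) \<in> parcs G ^^ Suc n"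
    by (simp only: relpow.simps(2) relcomp_unfold mem_Collect_eq prod.case)
  finally show ?case .
qed

text \<open>For \<open>a \<noteq> b\<close> no walk has length 0, so all lengths are successors. For
  \<open>a = b\<close> the right-hand side would be 2 instead of 0.\<close>

lemma dist_on_line:
  assumes "a \<in> parcs G" "b \<in> parcs G" "a \<noteq> b"
  shows "dist_on (step_digraph (line_mixed_graph G)) a b = 1 + dist_on G (snd a) (fst b)"
proof -
  let ?W = "{n. (snd a, fst b) \<in> parcs G ^^ n}"
  have "{n. (a, b) \<in> parcs (step_digraph (line_mixed_graph G)) ^^ n} = Suc ` ?W"
  proof (rule set_eqI)
    fix n
    show "n \<in> {n. (a, b) \<in> parcs (step_digraph (line_mixed_graph G)) ^^ n} \<longleftrightarrow> n \<in> Suc ` ?W"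
      using assms relpow_Suc_step_line[of a b]
      by (cases n) (auto simp del: relpow.simps(2))
  qed
  then have "dist_on (step_digraph (line_mixed_graph G)) a b = (INF n \<in> Suc ` ?W. ereal (real n))"
    using assms by (simp only: line.dist_on_eq_INF_relpow pverts_step_line)
  also have "\<dots> = (INF n \<in> ?W. 1 + ereal (real n))"
    unfolding image_image by (rule arg_cong[where f = Inf], rule image_cong) simp_all
  also have "\<dots> = 1 + (INF n \<in> ?W. ereal (real n))"
  \<comment> \<open>If no walk exists, both infima are \<infinity>; otherwise adding 1 commutes with
    the infimum.\<close>
  proof (cases "?W = {}")
    case False
    then show ?thesis by (intro INF_ereal_add_right) auto
  qed (simp add: top_ereal_def)
  also have "\<dots> = 1 + dist_on G (snd a) (fst b)"
    using assms pair_wf_digraph_axioms by (simp add: dist_on_eq_INF_relpow arc_snd_in_verts)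
  finally show ?thesis .
qed

end

section \<open>Regular graphs: counting arcs by tail and by head\<close>

locale regular_pair_graph = pair_graph G for G :: "'a pair_pre_digraph" +
  fixes d :: nat
  assumes regular: "v \<in> pverts G \<Longrightarrow> out_degree G v = d"
begin

lemma card_parcs_fst: "v \<in> pverts G \<Longrightarrow> card {a \<in> parcs G. fst a = v} = d"
  using regular by (simp add: out_degree_def out_arcs_def)

text \<open>Reversal is a bijection between the arcs leaving and those entering
  \<open>v\<close>.\<close>

lemma card_parcs_snd:
  assumes "v \<in> pverts G"
  shows "card {a \<in> parcs G. snd a = v} = d"
proof -
  have "{a \<in> parcs G. snd a = v} = prod.swap ` {a \<in> parcs G. fst a = v}"
    by (force intro: parcs_sym)
  then show ?thesis
    using card_parcs_fst[OF assms] by (simp add: card_image inj_on_def)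
qed

text \<open>Grouping the arcs by tail makes each vertex count \<open>d\<close> times; this turns
  sums over vertices of the line digraph into sums over vertices of \<open>G\<close>.\<close>

lemma sum_parcs_fst: "(\<Sum>a \<in> parcs G. f (fst a)) = real d * (\<Sum>v \<in> pverts G. f v)"
proof -
  have "(\<Sum>a \<in> parcs G. f (fst a)) = (\<Sum>v \<in> pverts G. \<Sum>a \<in> {a \<in> parcs G. fst a = v}. f (fst a))"
    by (rule sum.group[symmetric])
      (auto dest: in_arcsD1)
  also have "\<dots> = (\<Sum>v \<in> pverts G. real d * f v)"
    by (rule sum.cong) (simp_all add: card_parcs_fst)
  finally show ?thesis by (simp add: sum_distrib_left)
qed

lemma sum_parcs_snd: "(\<Sum>a \<in> parcs G. f (snd a)) = real d * (\<Sum>v \<in> pverts G. f v)"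
proof -
  have "(\<Sum>a \<in> parcs G. f (snd a)) = (\<Sum>v \<in> pverts G. \<Sum>a \<in> {a \<in> parcs G. snd a = v}. f (snd a))"
    by (rule sum.group[symmetric])
      (auto dest: in_arcsD2)
  also have "\<dots> = (\<Sum>v \<in> pverts G. real d * f v)"
    by (rule sum.cong) (simp_all add: card_parcs_snd)
  finally show ?thesis by (simp add: sum_distrib_left)
qed

lemma card_parcs: "card (parcs G) = d * card (pverts G)"
proof -
  have "real (card (parcs G)) = real (d * card (pverts G))"
    using sum_parcs_fst[of "\<lambda>_. 1"] by simp
  then show ?thesis by (simp only: of_nat_eq_iff)
qed

section \<open>Degrees in the line digraph\<close>

lemma undirected_degree_line:
  assumes "a \<in> parcs G"
  shows "undirected_degree (line_mixed_graph G) a = 1"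
proof -
  obtain u v where a: "a = (u, v)" by fastforce
  have "{e \<in> medges (line_mixed_graph G). a \<in> e} = {{(u, v), (v, u)}}"
    using assms a by (auto simp: line_mixed_graph_def)
  then show ?thesis by (simp add: undirected_degree_def)
qed

text \<open>Of the \<open>d\<close> arcs leaving the head of \<open>a\<close>, the reverse of
  \<open>a\<close> is lost to the edge.\<close>

lemma arc_out_degree_line:
  assumes "a \<in> parcs G"
  shows "arc_out_degree (line_mixed_graph G) a = d - 1"
proof -
  obtain u v where a: "a = (u, v)" by fastforce
  have "{e \<in> marcs (line_mixed_graph G). fst e = a} =
      Pair a ` ({b \<in> parcs G. fst b = v} - {(v, u)})"
    using assms a by (auto simp: line_mixed_graph_def)
  then have "arc_out_degree (line_mixed_graph G) a = card ({b \<in> parcs G. fst b = v} - {(v, u)})"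
    by (simp add: arc_out_degree_def card_image inj_on_def)
  also have "\<dots> = d - 1"
    using assms a card_parcs_fst[of v] by (simp add: parcs_sym in_arcsD2)
  finally show ?thesis .
qed

lemma arc_in_degree_line:
  assumes "a \<in> parcs G"
  shows "arc_in_degree (line_mixed_graph G) a = d - 1"
proof -
  obtain u v where a: "a = (u, v)" by fastforce
  have "{e \<in> marcs (line_mixed_graph G). snd e = a} =
      (\<lambda>b. (b, a)) ` ({b \<in> parcs G. snd b = u} - {(v, u)})"
    using assms a by (auto simp: line_mixed_graph_def)
  then have "arc_in_degree (line_mixed_graph G) a = card ({b \<in> parcs G. snd b = u} - {(v, u)})"
    by (simp add: arc_in_degree_def card_image inj_on_def)
  also have "\<dots> = d - 1"
    using assms a card_parcs_snd[of u] by (simp add: parcs_sym in_arcsD1)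
  finally show ?thesis .
qed

section \<open>Diameter and average distance of the line digraph\<close>

lemma diameter_on_line:
  assumes "d > 1" "pverts G \<noteq> {}"
  shows "diameter_on (step_digraph (line_mixed_graph G)) = 1 + diameter_on G"
proof (rule antisym)
  have "dist_on (step_digraph (line_mixed_graph G)) a b \<le> 1 + diameter_on G"
    if "a \<in> parcs G" "b \<in> parcs G" for a b
  proof -
    have le: "dist_on G (snd a) (fst b) \<le> diameter_on G"
      using that by (intro dist_on_le_diameter_on) (auto dest: in_arcsD1 in_arcsD2)
    \<comment> \<open>This settles the diagonal case \<open>a = b\<close>, where the distance is
      0.\<close>
    have "0 \<le> 1 + diameter_on G"
      using order_trans[OF dist_on_nonneg le] by simp
    then show ?thesis
      using that le by (cases "a = b") (auto simp: line.dist_on_refl dist_on_line intro: add_left_mono)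
  qed
  then show "diameter_on (step_digraph (line_mixed_graph G)) \<le> 1 + diameter_on G"
    by (subst diameter_on_def) (auto intro!: SUP_least)
next
  obtain v x where vx: "v \<in> pverts G" "x \<in> pverts G" "dist_on G v x = diameter_on G"
    using diameter_on_attained[of "with_proj G"] assms pair_finite_verts by auto
  have "{a \<in> parcs G. snd a = v} \<noteq> {}"
    using card_parcs_snd[OF vx(1)] assms(1) by (metis card.empty not_less_zero)
  then obtain a where a: "a \<in> parcs G" "snd a = v" by auto
  \<comment> \<open>The arc \<open>a\<close> may itself start at \<open>x\<close>;
    \<open>d > 1\<close> provides another one, so that \<open>dist_on_line\<close> applies.\<close>
  have "\<not> {b \<in> parcs G. fst b = x} \<subseteq> {a}"
    using card_mono[of "{a}" "{b \<in> parcs G. fst b = x}"] card_parcs_fst[OF vx(2)] assms(1) by auto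
  then obtain b where "b \<in> parcs G" "fst b = x" "b \<noteq> a" by auto
  then have "1 + diameter_on G = dist_on (step_digraph (line_mixed_graph G)) a b"
    using a vx(3) by (simp add: dist_on_line)
  also have "\<dots> \<le> diameter_on (step_digraph (line_mixed_graph G))"
    using a \<open>b \<in> parcs G\<close> by (intro dist_on_le_diameter_on) auto
  finally show "1 + diameter_on G \<le> diameter_on (step_digraph (line_mixed_graph G))" .
qed

lemma average_distance_line:
  assumes "d > 0" "pverts G \<noteq> {}" "diameter_on G < \<infinity>"
  shows "average_distance (step_digraph (line_mixed_graph G)) < average_distance G + 1"
proof -
  define f where "f u v = real_of_ereal (dist_on G u v)" for u v
  define g where "g a b = real_of_ereal (dist_on (step_digraph (line_mixed_graph G)) a b)" for a b
  let ?A = "parcs G" and ?V = "pverts G"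
  have f_nonneg: "0 \<le> f u v" for u v
    by (simp add: f_def real_of_ereal_pos dist_on_nonneg)
  have g_neq: "g a b = 1 + f (snd a) (fst b)" if "a \<in> ?A" "b \<in> ?A" "a \<noteq> b" for a b
  proof -
    have "dist_on G (snd a) (fst b) \<le> diameter_on G"
      using that by (intro dist_on_le_diameter_on) (auto dest: in_arcsD1 in_arcsD2)
    \<comment> \<open>Since \<open>real_of_ereal\<close> sends \<infinity> to 0, it commutes with
      adding 1 only at finite distances.\<close>
    then have "\<bar>dist_on G (snd a) (fst b)\<bar> \<noteq> \<infinity>"
      using assms(3) dist_on_nonneg[of "snd a" "fst b"] by auto
    then show ?thesis
      using that by (auto simp: g_def f_def dist_on_line)
  qed
  have g_eq: "g a a = 0" if "a \<in> ?A" for a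
    using that by (simp add: g_def line.dist_on_refl)
  have V: "card ?V > 0"
    using assms(2) pair_finite_verts by (simp add: card_gt_0_iff)
  then have A: "card ?A > 0"
    using assms(1) by (simp add: card_parcs)
  then obtain a where "a \<in> ?A" by (auto simp: card_gt_0_iff)
  have "(\<Sum>(a, b) \<in> ?A \<times> ?A. g a b) < (\<Sum>(a, b) \<in> ?A \<times> ?A. 1 + f (snd a) (fst b))"
  proof (rule sum_strict_mono_ex1)
    show "\<forall>x \<in> ?A \<times> ?A. (case x of (a, b) \<Rightarrow> g a b) \<le> (case x of (a, b) \<Rightarrow> 1 + f (snd a) (fst b))"
    proof safe
      fix u v x y assume "(u, v) \<in> ?A" "(x, y) \<in> ?A"
      then show "g (u, v) (x, y) \<le> 1 + f (snd (u, v)) (fst (x, y))"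
        using g_eq g_neq f_nonneg[of v x] by (cases "(u, v) = (x, y)") auto
    qed
    \<comment> \<open>A diagonal pair gives strictness: its distance is 0, while the bound is at
      least 1.\<close>
    show "\<exists>x \<in> ?A \<times> ?A. (case x of (a, b) \<Rightarrow> g a b) < (case x of (a, b) \<Rightarrow> 1 + f (snd a) (fst b))"
      using \<open>a \<in> ?A\<close> g_eq f_nonneg[of "snd a" "fst a"] by (intro bexI[of _ "(a, a)"]) auto
  qed (simp add: pair_finite_arcs)
  also have "\<dots> = (real (card ?A))\<^sup>2 + (\<Sum>a \<in> ?A. \<Sum>b \<in> ?A. f (snd a) (fst b))"
    by (simp add: sum.cartesian_product[symmetric] sum.distrib power2_eq_square)
  \<comment> \<open>The inner sum groups \<open>b\<close> by tail, the outer one \<open>a\<close> by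
    head; each yields a factor \<open>d\<close>.\<close>
  also have "(\<Sum>a \<in> ?A. \<Sum>b \<in> ?A. f (snd a) (fst b)) = real d * (\<Sum>u \<in> ?V. real d * (\<Sum>v \<in> ?V. f u v))"
    by (simp only: sum_parcs_fst sum_parcs_snd[of "\<lambda>u. real d * sum (f u) ?V"])
  also have "\<dots> = (real d)\<^sup>2 * (\<Sum>(u, v) \<in> ?V \<times> ?V. f u v)"
    by (simp add: sum.cartesian_product[symmetric] sum_distrib_left[symmetric] power2_eq_square)
  finally have "(\<Sum>(a, b) \<in> ?A \<times> ?A. g a b) / (real (card ?A))\<^sup>2 <
      ((real (card ?A))\<^sup>2 + (real d)\<^sup>2 * (\<Sum>(u, v) \<in> ?V \<times> ?V. f u v)) / (real (card ?A))\<^sup>2"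
    using A by (intro divide_strict_right_mono) auto
  \<comment> \<open>By \<open>card_parcs\<close> the denominator is the square of
    \<open>d * card ?V\<close>, so \<open>d\<close> cancels from the sum and the other term becomes
    1.\<close>
  also have "\<dots> = (\<Sum>(u, v) \<in> ?V \<times> ?V. f u v) / (real (card ?V))\<^sup>2 + 1"
  proof -
    have "((x * y)\<^sup>2 + x\<^sup>2 * s) / (x * y)\<^sup>2 = s / y\<^sup>2 + 1" if "x > 0" "y > 0" for x y s :: real
      using that by (simp add: field_simps)
    then show ?thesis
      using assms(1) V by (simp only: card_parcs of_nat_mult of_nat_0_less_iff)
  qed
  finally show ?thesis
    by (simp add: average_distance_def f_def g_def)
qed

end

theorem lemma4p1:
  fixes \<delta> n k :: nat and kbar :: real and H :: "'a pair_pre_digraph"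
  assumes "\<delta> > 1"
    and "pair_graph H"
    and "Digraph_Component.connected (with_proj H)"
    and "\<forall>v \<in> pverts H. out_degree (with_proj H) v = \<delta>"
    and "card (pverts H) = n"
    and "diameter_on (with_proj H) = ereal (real k)"
    and "average_distance (with_proj H) = kbar"
  shows "\<exists>G :: ('a \<times> 'a) mixed_graph.
           rzk_mixed_graph 1 (\<delta> - 1) (k + 1) G \<and>
           card (mverts G) = \<delta> * n \<and>
           average_distance (with_proj (step_digraph G)) < kbar + 1"
proof -
  interpret pair_graph H by fact
  interpret regular_pair_graph H \<delta>
    using assms(4) by unfold_locales auto
  \<comment> \<open>Strong connectivity, through which \<open>connected\<close> is defined, includes
    having a vertex.\<close>
  have V: "pverts H \<noteq> {}"
    using assms(3) by (auto simp: connected_def strongly_connected_def mk_symmetric_def)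
  interpret line: mixed_graph "line_mixed_graph H"
    by (rule mixed_graph_line)
  have "rzk_mixed_graph 1 (\<delta> - 1) (k + 1) (line_mixed_graph H)"
  proof
    show "diameter_on (with_proj (step_digraph (line_mixed_graph H))) = ereal (real (k + 1))"
      using diameter_on_line[OF assms(1) V] assms(6) by (simp add: add.commute)
  qed (simp_all add: undirected_degree_line arc_out_degree_line arc_in_degree_line)
  moreover have "card (mverts (line_mixed_graph H)) = \<delta> * n"
    using card_parcs assms(5) by simp
  moreover have "average_distance (with_proj (step_digraph (line_mixed_graph H))) < kbar + 1"
    using average_distance_line V assms(1,6,7) by simp
  ultimately show ?thesis by blast
qed

end
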